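(* The solutions $(A(q),B(q),C(q))$ of the deformed squared Markov equation $$X^2+Y^2+Z^2+(q+q^{-1})(XY+YZ+XZ)=3(1+q+q^{-1})XYZ$$ whose entries are symmetric Laurent polynomials in $q$ with positive integer coefficients are exactly the vertices of the deformed squared Markov tree.
   Context: Let $q$ be an indeterminate. A solution of the equation is a triple of Laurent polynomials in $q$ with integer coefficients satisfying it. Given a solution $(A,B,C)$ with non-zero entries, the mutation at $A$ replaces $A$ by $$A'=\frac{B^2+(q+q^{-1})BC+C^2}{A}=3(1+q+q^{-1})BC-(q+q^{-1})(B+C)-A,$$ leaving $B,C$ unchanged; mutations at $B$ and at $C$ are defined in the same way by exchanging the roles of the coordinates. The deformed squared Markov tree is the graph whose vertices are all triples obtained from the solution $(1,1,1)$ by finite sequences of mutations (at any coordinates), with edges given by mutations. A Laurent polynomial $A(q)$ is symmetric if $A(q)=A(q^{-1})$. "With positive integer coefficients" means non-zero, with all non-zero coefficients being positive integers. *)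

theory Defs
  imports "HOL-Library.Poly_Mapping"
begin

text \<open>Laurent polynomials in \<open>q\<close> with integer coefficients, as the group ring of the integers:
  the coefficient of \<open>q\<close> to the power \<open>k\<close> in \<open>A\<close> is \<open>Poly_Mapping.lookup A k\<close>, and
  multiplication is convolution.\<close>

type_synonym laurent = "int \<Rightarrow>\<^sub>0 int"

definition q :: laurent where
  "q = Poly_Mapping.single 1 1"

definition q_inv :: laurent where
  "q_inv = Poly_Mapping.single (- 1) 1"

lemma q_mult_q_inv: "q * q_inv = 1"
  by (simp add: q_def q_inv_def Poly_Mapping.mult_single)

text \<open>The substitution of the inverse of \<open>q\<close> for \<open>q\<close>.\<close>

definition subst_q_inv :: "laurent \<Rightarrow> laurent" where
  "subst_q_inv A = Poly_Mapping.map_key uminus A"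

lemma lookup_subst_q_inv: "Poly_Mapping.lookup (subst_q_inv A) k = Poly_Mapping.lookup A (- k)"
  by (simp add: subst_q_inv_def map_key.rep_eq)

definition symmetric :: "laurent \<Rightarrow> bool" where
  "symmetric A \<longleftrightarrow> A = subst_q_inv A"

definition positive_coeffs :: "laurent \<Rightarrow> bool" where
  "positive_coeffs A \<longleftrightarrow>
     A \<noteq> 0 \<and> (\<forall>k. Poly_Mapping.lookup A k \<noteq> 0 \<longrightarrow> Poly_Mapping.lookup A k > 0)"

fun is_solution :: "laurent \<times> laurent \<times> laurent \<Rightarrow> bool" where
  "is_solution (X, Y, Z) \<longleftrightarrow>
     X ^ 2 + Y ^ 2 + Z ^ 2 + (q + q_inv) * (X * Y + Y * Z + X * Z)
       = 3 * (1 + q + q_inv) * X * Y * Z"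

text \<open>The entry that replaces \<open>A\<close> in the mutation of \<open>(A, B, C)\<close> at \<open>A\<close>.\<close>

definition mutated_entry :: "laurent \<Rightarrow> laurent \<Rightarrow> laurent \<Rightarrow> laurent" where
  "mutated_entry A B C = 3 * (1 + q + q_inv) * B * C - (q + q_inv) * (B + C) - A"

text \<open>On solutions with \<open>A\<close> non-zero this is the quotient of
  \<open>B ^ 2 + (q + q_inv) * B * C + C ^ 2\<close> by \<open>A\<close>.\<close>

lemma mutated_entry_eq_quotient:
  assumes "is_solution (A, B, C)" and "A \<noteq> 0"
  shows "A' = mutated_entry A B C \<longleftrightarrow> A * A' = B ^ 2 + (q + q_inv) * B * C + C ^ 2"
proof -
  have "A * mutated_entry A B C = B ^ 2 + (q + q_inv) * B * C + C ^ 2"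
    using assms(1) by (simp add: mutated_entry_def algebra_simps power2_eq_square)
  then show ?thesis
    using assms(2) by (metis mult_left_cancel)
qed

text \<open>The edges of the graph: only solutions with non-zero entries are mutated.\<close>

inductive mutation ::
  "laurent \<times> laurent \<times> laurent \<Rightarrow> laurent \<times> laurent \<times> laurent \<Rightarrow> bool" where
  at_fst: "\<lbrakk>is_solution (A, B, C); A \<noteq> 0; B \<noteq> 0; C \<noteq> 0\<rbrakk>
    \<Longrightarrow> mutation (A, B, C) (mutated_entry A B C, B, C)"
| at_snd: "\<lbrakk>is_solution (A, B, C); A \<noteq> 0; B \<noteq> 0; C \<noteq> 0\<rbrakk>
    \<Longrightarrow> mutation (A, B, C) (A, mutated_entry B A C, C)"
| at_thd: "\<lbrakk>is_solution (A, B, C); A \<noteq> 0; B \<noteq> 0; C \<noteq> 0\<rbrakk>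
    \<Longrightarrow> mutation (A, B, C) (A, B, mutated_entry C A B)"

definition tree_vertices :: "(laurent \<times> laurent \<times> laurent) set" where
  "tree_vertices = {t. mutation\<^sup>*\<^sup>* (1, 1, 1) t}"

end

theory Submission
  imports Defs
begin

text \<open>Both sides of the theorem are compared with a third set, which mutations visibly preserve: the
  symmetric solutions whose entries have a \<^emph>\<open>positive leading coefficient\<close>
  (\<open>positive_leading_solution\<close>). Positivity of all coefficients is hard to carry through the
  division in a mutation, but positivity of the leading coefficient is not: the product
  \<open>A A' = B\<^sup>2 + (q + q\<inverse>) B C + C\<^sup>2\<close> has a positive leading coefficient, hence so has \<open>A'\<close>, and
  its degree is known. So all vertices of the tree belong to this set, and so do all symmetric
  solutions with positive coefficients.

  It remains to see that a solution in this set lies in the tree and has positive coefficients; this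
  is \<open>positive_leading_solution_descent\<close>. Let \<open>a \<ge> b \<ge> c \<ge> 0\<close> be the degrees of the entries. No
  leading terms cancel on either side of the equation, so
  \<open>max (2a) (1 + a + b) = 1 + a + b + c\<close>. Either \<open>a = b + c + 1\<close>, or \<open>c = 0\<close> and \<open>a = b\<close>. In the
  second case \<open>C\<close> is a positive integer, and \<open>3C - 1 > 0\<close> makes the \<open>q A B\<close> terms of the two
  sides unequal unless \<open>a = 0\<close>; the equation for three positive integers then forces \<open>(1, 1, 1)\<close>
  (\<open>solution_degrees\<close>). In the first case the mutation at \<open>A\<close> produces an entry of degree
  \<open>max (b - c - 1) 0 < a\<close>. Hence every solution in the set descends to the root by mutations, and
  since mutations are involutions it is a vertex of the tree.

  Positivity of all coefficients is recovered on the way back up. Suppose that in the smaller triple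
  \<open>(A', B, C)\<close> all entries are coefficientwise at least \<open>1\<close> and that \<open>B\<close> is coefficientwise at
  least \<open>A'\<close>. Then
  \<open>3 (1 + q + q\<inverse>) B C\<close> absorbs the subtracted terms of the mutation, with at least \<open>B C\<close> left
  over, so that \<open>A\<close> is coefficientwise at least \<open>B\<close>, \<open>C\<close> and \<open>1\<close>
  (\<open>mult_coeff_le_mutated_entry\<close>); the same holds with \<open>B\<close> and \<open>C\<close> exchanged. The invariant that
  makes this an induction is that one entry is coefficientwise above the other two
  (\<open>dominated\<close>), and the degrees show that this entry is not \<open>A'\<close> alone.\<close>

section \<open>Coefficients of products\<close>

lemma lookup_times_laurent:
  fixes A B :: laurent
  shows "Poly_Mapping.lookup (A * B) k
    = (\<Sum>l\<in>Poly_Mapping.keys A. Poly_Mapping.lookup A l * Poly_Mapping.lookup B (k - l))"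
proof -
  have inner: "(\<Sum>m. Poly_Mapping.lookup B m when k = l + m) = Poly_Mapping.lookup B (k - l)" for l
  proof -
    have "(\<lambda>m. Poly_Mapping.lookup B m when k = l + m)
        = (\<lambda>m. Poly_Mapping.lookup B m when m = k - l)"
      by (auto simp: when_def fun_eq_iff)
    then show ?thesis
      by (simp only: Sum_any_when_equal)
  qed
  have "Poly_Mapping.lookup (A * B) k
      = (\<Sum>l. Poly_Mapping.lookup A l * Poly_Mapping.lookup B (k - l))"
    by (simp add: lookup_mult inner)
  also have "\<dots> = (\<Sum>l\<in>Poly_Mapping.keys A. Poly_Mapping.lookup A l * Poly_Mapping.lookup B (k - l))"
    by (rule Sum_any.expand_superset) (auto simp: in_keys_iff)
  finally show ?thesis .
qed

section \<open>Symmetric Laurent polynomials\<close>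

lemma symmetric_iff_lookup:
  "symmetric A \<longleftrightarrow> (\<forall>k. Poly_Mapping.lookup A (- k) = Poly_Mapping.lookup A k)"
  unfolding symmetric_def poly_mapping_eq_iff fun_eq_iff lookup_subst_q_inv by metis

lemma symmetric_one: "symmetric 1"
  by (simp add: symmetric_iff_lookup lookup_one when_def)

lemma symmetric_q_plus_q_inv: "symmetric (q + q_inv)"
  by (auto simp: symmetric_iff_lookup q_def q_inv_def lookup_add lookup_single when_def)

lemma symmetric_add: "symmetric A \<Longrightarrow> symmetric B \<Longrightarrow> symmetric (A + B)"
  by (simp add: symmetric_iff_lookup lookup_add)

lemma symmetric_diff: "symmetric A \<Longrightarrow> symmetric B \<Longrightarrow> symmetric (A - B)"
  by (simp add: symmetric_iff_lookup lookup_minus)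

lemma symmetric_mult:
  assumes "symmetric A" "symmetric B"
  shows "symmetric (A * B)"
  unfolding symmetric_iff_lookup lookup_times_laurent
proof
  fix k
  have A: "Poly_Mapping.lookup A (- l) = Poly_Mapping.lookup A l"
    and B: "Poly_Mapping.lookup B (- l) = Poly_Mapping.lookup B l" for l
    using assms by (simp_all add: symmetric_iff_lookup)
  have "Poly_Mapping.lookup B (- k - l) = Poly_Mapping.lookup B (k - - l)" for l
    using B[of "k + l"] by simp
  then show "(\<Sum>l\<in>Poly_Mapping.keys A. Poly_Mapping.lookup A l * Poly_Mapping.lookup B (- k - l))
      = (\<Sum>l\<in>Poly_Mapping.keys A. Poly_Mapping.lookup A l * Poly_Mapping.lookup B (k - l))"
    by (intro sum.reindex_bij_witness[where i = uminus and j = uminus])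
      (auto simp: A in_keys_iff)
qed

text \<open>The factor \<open>3\<close> is expanded into a sum, so that closure under ring operations alone proves that
  mutations preserve symmetry.\<close>

lemma mutated_entry_eq:
  "mutated_entry A B C = (1 + (q + q_inv)) * (B * C + B * C + B * C) - (q + q_inv) * (B + C) - A"
  by (simp add: mutated_entry_def algebra_simps)

lemma symmetric_mutated_entry:
  "symmetric A \<Longrightarrow> symmetric B \<Longrightarrow> symmetric C \<Longrightarrow> symmetric (mutated_entry A B C)"
  unfolding mutated_entry_eq
  by (intro symmetric_diff symmetric_mult symmetric_add symmetric_q_plus_q_inv symmetric_one)

section \<open>Degrees and positive leading coefficients\<close>

text \<open>Positivity of the leading coefficient is part of the notion, so that leading terms never cancel in
  sums and degrees of sums and products can be computed exactly.\<close>

definition has_degree :: "laurent \<Rightarrow> int \<Rightarrow> bool" where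
  "has_degree A d \<longleftrightarrow>
     Poly_Mapping.lookup A d > 0 \<and> (\<forall>k>d. Poly_Mapping.lookup A k = 0)"

lemma has_degree_unique: "has_degree A d \<Longrightarrow> has_degree A e \<Longrightarrow> d = e"
  unfolding has_degree_def by (metis less_irrefl linorder_neqE)

lemma has_degree_nonzero: "has_degree A d \<Longrightarrow> A \<noteq> 0"
  by (auto simp: has_degree_def)

lemma has_degree_single: "n > 0 \<Longrightarrow> has_degree (Poly_Mapping.single d n) d"
  by (simp add: has_degree_def lookup_single)

lemma has_degree_one: "has_degree 1 0"
  by (simp add: has_degree_def lookup_one)

lemma has_degree_q_plus_q_inv: "has_degree (q + q_inv) 1"
  by (auto simp: has_degree_def q_def q_inv_def lookup_add lookup_single when_def)

lemma has_degree_add: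
  "has_degree A d \<Longrightarrow> has_degree B e \<Longrightarrow> has_degree (A + B) (max d e)"
  unfolding has_degree_def lookup_add by (cases d e rule: linorder_cases) auto

lemma lookup_mult_at_top:
  fixes A B :: laurent
  assumes A: "\<And>k. k > d \<Longrightarrow> Poly_Mapping.lookup A k = 0"
    and B: "\<And>k. k > e \<Longrightarrow> Poly_Mapping.lookup B k = 0"
  shows "Poly_Mapping.lookup (A * B) (d + e) = Poly_Mapping.lookup A d * Poly_Mapping.lookup B e"
    and "k > d + e \<Longrightarrow> Poly_Mapping.lookup (A * B) k = 0"
proof -
  have keys: "l \<le> d" if "l \<in> Poly_Mapping.keys A" for l
    using that A[of l] by (auto simp: in_keys_iff not_less[symmetric])
  have "Poly_Mapping.lookup A l * Poly_Mapping.lookup B (d + e - l)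
      = (if l = d then Poly_Mapping.lookup A d * Poly_Mapping.lookup B e else 0)"
    if "l \<in> Poly_Mapping.keys A" for l
    using keys[OF that] B[of "d + e - l"] by (cases "l = d") auto
  then show "Poly_Mapping.lookup (A * B) (d + e)
      = Poly_Mapping.lookup A d * Poly_Mapping.lookup B e"
    by (simp add: lookup_times_laurent in_keys_iff)
  show "Poly_Mapping.lookup (A * B) k = 0" if "k > d + e"
    unfolding lookup_times_laurent
  proof (rule sum.neutral, rule ballI)
    fix l assume "l \<in> Poly_Mapping.keys A"
    from keys[OF this] that show "Poly_Mapping.lookup A l * Poly_Mapping.lookup B (k - l) = 0"
      by (simp add: B)
  qed
qed

lemma has_degree_mult:
  "has_degree A d \<Longrightarrow> has_degree B e \<Longrightarrow> has_degree (A * B) (d + e)"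
  unfolding has_degree_def using lookup_mult_at_top[of d A e B] by auto

lemma nonzero_top_coefficient:
  fixes A :: laurent
  assumes "A \<noteq> 0"
  obtains d where "Poly_Mapping.lookup A d \<noteq> 0" "\<And>k. k > d \<Longrightarrow> Poly_Mapping.lookup A k = 0"
proof
  let ?d = "Max (Poly_Mapping.keys A)"
  have "?d \<in> Poly_Mapping.keys A"
    using assms by (intro Max_in) auto
  then show "Poly_Mapping.lookup A ?d \<noteq> 0"
    by (simp add: in_keys_iff)
  show "Poly_Mapping.lookup A k = 0" if "k > ?d" for k
    using that by (metis Max_ge finite_keys in_keys_iff leD)
qed

lemma positive_coeffs_has_degree:
  assumes "positive_coeffs A"
  shows "\<exists>d. has_degree A d"
proof -
  obtain d where "Poly_Mapping.lookup A d \<noteq> 0" "\<And>k. k > d \<Longrightarrow> Poly_Mapping.lookup A k = 0"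
    using assms nonzero_top_coefficient by (auto simp: positive_coeffs_def)
  with assms show ?thesis
    by (auto simp: positive_coeffs_def has_degree_def)
qed

text \<open>This replaces the division in a mutation: leading coefficients multiply, so the sign and the degree
  of a quotient are determined even where its other coefficients are out of control.\<close>

lemma has_degree_cofactor:
  assumes "has_degree (A * B) n" "has_degree A d"
  shows "has_degree B (n - d)"
proof -
  have "B \<noteq> 0"
    using has_degree_nonzero[OF assms(1)] by auto
  then obtain e where e: "Poly_Mapping.lookup B e \<noteq> 0"
      "\<And>k. k > e \<Longrightarrow> Poly_Mapping.lookup B k = 0"
    by (rule nonzero_top_coefficient) blast
  have A: "Poly_Mapping.lookup A d > 0" "\<And>k. k > d \<Longrightarrow> Poly_Mapping.lookup A k = 0"
    using assms(2) by (auto simp: has_degree_def)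
  have AB: "Poly_Mapping.lookup (A * B) n > 0" "\<And>k. k > n \<Longrightarrow> Poly_Mapping.lookup (A * B) k = 0"
    using assms(1) by (auto simp: has_degree_def)
  note top = lookup_mult_at_top[of d A e B, OF A(2) e(2)]
  have n: "n = d + e"
    using top(1) top(2)[of n] AB(1) AB(2)[of "d + e"] A(1) e(1)
    by (cases n "d + e" rule: linorder_cases) auto
  then have "Poly_Mapping.lookup A d * Poly_Mapping.lookup B e > 0"
    using top(1) AB(1) by simp
  then show ?thesis
    using A(1) e(2) n by (simp add: has_degree_def zero_less_mult_iff)
qed

lemma symmetric_degree_nonneg:
  assumes "symmetric A" "has_degree A d"
  shows "d \<ge> 0"
proof (rule ccontr)
  assume "\<not> d \<ge> 0"
  then have "- d > d" by simp
  then have "Poly_Mapping.lookup A (- d) = 0"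
    using assms(2) by (simp add: has_degree_def)
  with assms show False
    by (simp add: symmetric_iff_lookup has_degree_def)
qed

lemma symmetric_degree_zero:
  assumes "symmetric A" "has_degree A 0"
  obtains n where "n > 0" "A = Poly_Mapping.single 0 n"
proof
  show "Poly_Mapping.lookup A 0 > 0"
    using assms(2) by (simp add: has_degree_def)
  show "A = Poly_Mapping.single 0 (Poly_Mapping.lookup A 0)"
  proof (rule poly_mapping_eqI)
    fix k
    have "Poly_Mapping.lookup A k = 0" if "k \<noteq> 0"
      using that assms by (cases "k > 0") (auto simp: has_degree_def symmetric_iff_lookup dest: spec[of _ "- k"])
    then show "Poly_Mapping.lookup A k
        = Poly_Mapping.lookup (Poly_Mapping.single 0 (Poly_Mapping.lookup A 0)) k"
      by (simp add: lookup_single when_def)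
  qed
qed

section \<open>Degrees of the entries of a solution\<close>

text \<open>For constants the equation splits into the coefficients of \<open>1\<close> and of \<open>q\<close>, giving
  \<open>x\<^sup>2 + y\<^sup>2 + z\<^sup>2 = 3xyz = xy + yz + xz\<close>. Equality of the outer terms means that the sum of the
  squared differences vanishes, so \<open>x = y = z\<close> and \<open>x\<^sup>2 = x\<^sup>3\<close>.\<close>

lemma constant_solution:
  assumes sol: "is_solution (Poly_Mapping.single 0 x, Poly_Mapping.single 0 y, Poly_Mapping.single 0 z)"
    and pos: "x > 0" "y > 0" "z > 0"
  shows "x = 1 \<and> y = 1 \<and> z = 1"
proof -
  let ?c = "\<lambda>n :: int. (Poly_Mapping.single 0 n :: laurent)"
  let ?N = "x * x + y * y + z * z - 3 * x * y * z"
  let ?M = "x * y + y * z + x * z - 3 * x * y * z"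
  have hom: "?c (a * b) = ?c a * ?c b" "?c (a + b) = ?c a + ?c b" "?c (a - b) = ?c a - ?c b" for a b
    by (simp_all add: mult_single single_add single_diff)
  have three: "?c 3 = 3"
    by (simp add: single_numeral)
  have "?c ?N + (q + q_inv) * ?c ?M = 0"
    using sol unfolding hom three by (simp add: algebra_simps power2_eq_square)
  then have "Poly_Mapping.lookup (?c ?N + (q + q_inv) * ?c ?M) k = 0" for k
    by simp
  from this[of 0] this[of 1] have N: "?N = 0" and M: "?M = 0"
    by (simp_all add: lookup_add q_def q_inv_def distrib_right mult_single lookup_single when_def)
  \<comment> \<open>Comparing the two coefficient identities: a vanishing sum of squares.\<close>
  have "(x - y) * (x - y) + (y - z) * (y - z) + (x - z) * (x - z) = 2 * (?N - ?M)"
    by (simp add: algebra_simps)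
  also have "\<dots> = 0" using N M by simp
  finally have "(x - y) * (x - y) + (y - z) * (y - z) + (x - z) * (x - z) = 0" .
  then have "x = y" "y = z"
    by (smt (verit) zero_le_square mult_eq_0_iff)+
  with N have "3 * (x * x) * (1 - x) = 0"
    by (simp add: algebra_simps)
  with pos \<open>x = y\<close> \<open>y = z\<close> show ?thesis
    by simp
qed

text \<open>The degrees of the two sides of the equation are compared twice. In its given form the equation
  leaves only \<open>a = b + c + 1\<close> or \<open>c = 0, a = b\<close>. In the latter case both sides have the same
  degree because of the terms \<open>(q + q\<inverse>) A B\<close> and \<open>3 (q + q\<inverse>) A B C\<close>; since \<open>C\<close> is a positive
  integer, subtracting the former from the latter leaves \<open>(q + q\<inverse>) A B (3C - 1)\<close> of degree
  \<open>2a + 1\<close>, against \<open>max (2a) (a + 1)\<close> on the other side, whence \<open>a = 0\<close>.\<close>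

lemma solution_degrees:
  assumes sol: "is_solution (A, B, C)"
    and sym: "symmetric A" "symmetric B" "symmetric C"
    and deg: "has_degree A a" "has_degree B b" "has_degree C c"
    and ord: "b \<le> a" "c \<le> b"
  shows "A = 1 \<and> B = 1 \<and> C = 1 \<or> a = b + c + 1"
proof (rule disjCI)
  assume ne: "a \<noteq> b + c + 1"
  have c0: "c \<ge> 0"
    using symmetric_degree_nonneg sym deg by blast
  note deg_intros = has_degree_add has_degree_mult has_degree_q_plus_q_inv has_degree_one deg
  have lhs: "has_degree (A * A + (B * B + C * C) + (q + q_inv) * (A * B + (B * C + A * C)))
      (max (max (a + a) (max (b + b) (c + c))) (1 + max (a + b) (max (b + c) (a + c))))"
    by (intro deg_intros)
  have rhs: "has_degree ((1 + (q + q_inv)) * (1 + (1 + 1)) * (A * B * C))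
      (max 0 1 + max 0 (max 0 0) + (a + b + c))"
    by (intro deg_intros)
  have "A * A + (B * B + C * C) + (q + q_inv) * (A * B + (B * C + A * C))
      = (1 + (q + q_inv)) * (1 + (1 + 1)) * (A * B * C)"
    using sol by (simp add: algebra_simps power2_eq_square)
  with lhs rhs have "max (max (a + a) (max (b + b) (c + c))) (1 + max (a + b) (max (b + c) (a + c)))
      = max 0 1 + max 0 (max 0 0) + (a + b + c)"
    by (metis has_degree_unique)
  with ord c0 ne have c: "c = 0" and ab: "a = b"
    by (auto simp: max_def split: if_splits)
  obtain z where z: "z > 0" "C = Poly_Mapping.single 0 z"
    using symmetric_degree_zero[OF sym(3)] deg(3) unfolding c by metis
  \<comment> \<open>For a positive integer \<open>C\<close> the factor \<open>3C - 1\<close> is again a positive integer, so it does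
    not change degrees.\<close>
  define D where "D = 3 * C - 1"
  have "Poly_Mapping.single 0 (3 * z - 1) = Poly_Mapping.single 0 3 * C - Poly_Mapping.single 0 1"
    by (simp only: z(2) single_diff mult_single add_0)
  then have "D = Poly_Mapping.single 0 (3 * z - 1)"
    by (simp add: D_def single_numeral)
  then have D: "has_degree D 0"
    using z(1) by (simp add: has_degree_single)
  have lhs: "has_degree (A * A + (B * B + C * C) + (q + q_inv) * (B * C + A * C))
      (max (max (a + a) (max (b + b) (c + c))) (1 + max (b + c) (a + c)))"
    by (intro deg_intros)
  have rhs: "has_degree ((q + q_inv) * (A * B * D) + (1 + (1 + 1)) * (A * B * C))
      (max (1 + (a + b + 0)) (max 0 (max 0 0) + (a + b + c)))"
    by (intro deg_intros D)
  have "A * A + (B * B + C * C) + (q + q_inv) * (B * C + A * C)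
      = (q + q_inv) * (A * B * D) + (1 + (1 + 1)) * (A * B * C)"
    using sol by (simp add: D_def algebra_simps power2_eq_square)
  with lhs rhs have "max (max (a + a) (max (b + b) (c + c))) (1 + max (b + c) (a + c))
      = max (1 + (a + b + 0)) (max 0 (max 0 0) + (a + b + c))"
    by (metis has_degree_unique)
  with ab c ord c0 have zero: "a = 0" "b = 0"
    by (auto simp: max_def split: if_splits)
  obtain x where x: "x > 0" "A = Poly_Mapping.single 0 x"
    using symmetric_degree_zero[OF sym(1)] deg(1) unfolding zero by metis
  obtain y where y: "y > 0" "B = Poly_Mapping.single 0 y"
    using symmetric_degree_zero[OF sym(2)] deg(2) unfolding zero by metis
  with constant_solution[of x y z] x z sol show "A = 1 \<and> B = 1 \<and> C = 1"
    by simp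
qed

section \<open>Mutations of solutions with positive leading coefficients\<close>

definition positive_leading_solution :: "laurent \<times> laurent \<times> laurent \<Rightarrow> bool" where
  "positive_leading_solution = (\<lambda>(A, B, C). is_solution (A, B, C)
     \<and> symmetric A \<and> symmetric B \<and> symmetric C
     \<and> (\<exists>a. has_degree A a) \<and> (\<exists>b. has_degree B b) \<and> (\<exists>c. has_degree C c))"

lemma mutated_entry_commute: "mutated_entry A C B = mutated_entry A B C"
  by (simp add: mutated_entry_def algebra_simps)

lemma mutated_entry_involution: "mutated_entry (mutated_entry A B C) B C = A"
  by (simp add: mutated_entry_def)

lemma is_solution_mutated_entry:
  "is_solution (A, B, C) \<Longrightarrow> is_solution (mutated_entry A B C, B, C)"
  by (simp add: mutated_entry_def algebra_simps power2_eq_square)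

lemma is_solution_swap:
  "is_solution (A, B, C) \<Longrightarrow> is_solution (B, A, C)"
  "is_solution (A, B, C) \<Longrightarrow> is_solution (A, C, B)"
  by (simp_all add: algebra_simps)

lemma has_degree_mutated_entry:
  assumes "is_solution (A, B, C)"
    and deg: "has_degree A a" "has_degree B b" "has_degree C c"
  shows "has_degree (mutated_entry A B C) (max (max (b + b) (c + c)) (1 + (b + c)) - a)"
proof (rule has_degree_cofactor[OF _ deg(1)])
  have "A * mutated_entry A B C = B * B + C * C + (q + q_inv) * (B * C)"
    using assms(1) by (simp add: mutated_entry_def algebra_simps power2_eq_square)
  then show "has_degree (A * mutated_entry A B C) (max (max (b + b) (c + c)) (1 + (b + c)))"
    by (simp only:) (intro has_degree_add has_degree_mult has_degree_q_plus_q_inv deg)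
qed

lemma positive_leading_solution_swap:
  "positive_leading_solution (A, B, C) \<Longrightarrow> positive_leading_solution (B, A, C)"
  "positive_leading_solution (A, B, C) \<Longrightarrow> positive_leading_solution (A, C, B)"
  using is_solution_swap unfolding positive_leading_solution_def prod.case by blast+

lemma positive_leading_solution_mutated_entry:
  assumes "positive_leading_solution (A, B, C)"
  shows "positive_leading_solution (mutated_entry A B C, B, C)"
proof -
  obtain a b c where sol: "is_solution (A, B, C)"
    and sym: "symmetric A" "symmetric B" "symmetric C"
    and deg: "has_degree A a" "has_degree B b" "has_degree C c"
    using assms unfolding positive_leading_solution_def prod.case by blast
  then show ?thesis
    using is_solution_mutated_entry[OF sol] symmetric_mutated_entry[OF sym]
      has_degree_mutated_entry[OF sol deg]
    unfolding positive_leading_solution_def prod.case by blast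
qed

lemma positive_leading_solution_mutation:
  "mutation t u \<Longrightarrow> positive_leading_solution t \<Longrightarrow> positive_leading_solution u"
  by (induction rule: mutation.induct)
    (blast intro: positive_leading_solution_swap positive_leading_solution_mutated_entry)+

lemma positive_leading_solution_root: "positive_leading_solution (1, 1, 1)"
  using has_degree_one symmetric_one by (auto simp: positive_leading_solution_def)

lemma tree_vertices_positive_leading_solution:
  assumes "t \<in> tree_vertices"
  shows "positive_leading_solution t"
proof -
  have "mutation\<^sup>*\<^sup>* (1, 1, 1) t"
    using assms by (simp add: tree_vertices_def)
  then show ?thesis
    by (induction rule: rtranclp_induct)
      (auto intro: positive_leading_solution_root positive_leading_solution_mutation)
qed

section \<open>Permutation invariance of the tree\<close>

lemma tree_vertices_swap:
  assumes "(A, B, C) \<in> tree_vertices"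
  shows "(B, A, C) \<in> tree_vertices" "(A, C, B) \<in> tree_vertices"
proof -
  have "(case t of (A, B, C) \<Rightarrow> mutation\<^sup>*\<^sup>* (1, 1, 1) (B, A, C) \<and> mutation\<^sup>*\<^sup>* (1, 1, 1) (A, C, B))"
    if "mutation\<^sup>*\<^sup>* (1, 1, 1) t" for t
    using that
  proof (induction rule: rtranclp_induct)
    case base
    show ?case by simp
  next
    case (step t u)
    from step(2) have "case (t, u) of ((A, B, C), (A', B', C')) \<Rightarrow>
        mutation (B, A, C) (B', A', C') \<and> mutation (A, C, B) (A', C', B')"
    proof cases
      case (at_fst A B C)
      with mutation.at_snd[of B A C, OF is_solution_swap(1)]
        mutation.at_fst[of A C B, OF is_solution_swap(2)]
      show ?thesis
        by (simp add: mutated_entry_commute del: is_solution.simps)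
    next
      case (at_snd A B C)
      with mutation.at_fst[of B A C, OF is_solution_swap(1)]
        mutation.at_thd[of A C B, OF is_solution_swap(2)]
      show ?thesis
        by (simp add: mutated_entry_commute del: is_solution.simps)
    next
      case (at_thd A B C)
      with mutation.at_thd[of B A C, OF is_solution_swap(1)]
        mutation.at_snd[of A C B, OF is_solution_swap(2)]
      show ?thesis
        by (simp add: mutated_entry_commute[of C] del: is_solution.simps)
    qed
    with step(3) show ?case
      by (auto intro: rtranclp.rtrancl_into_rtrancl split: prod.splits)
  qed
  with assms show "(B, A, C) \<in> tree_vertices" "(A, C, B) \<in> tree_vertices"
    by (auto simp: tree_vertices_def)
qed

section \<open>Coefficientwise comparison\<close>

definition coeff_le :: "laurent \<Rightarrow> laurent \<Rightarrow> bool"  (infix \<open>\<preceq>\<close> 50) where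
  "A \<preceq> B \<longleftrightarrow> (\<forall>k. Poly_Mapping.lookup A k \<le> Poly_Mapping.lookup B k)"

lemma coeff_le_refl: "A \<preceq> A"
  by (simp add: coeff_le_def)

lemma coeff_le_trans: "A \<preceq> B \<Longrightarrow> B \<preceq> C \<Longrightarrow> A \<preceq> C"
  unfolding coeff_le_def by (meson order_trans)

lemma coeff_le_diff: "0 \<preceq> B - A \<longleftrightarrow> A \<preceq> B"
  by (simp add: coeff_le_def lookup_minus)

lemma coeff_nonneg_add: "0 \<preceq> A \<Longrightarrow> 0 \<preceq> B \<Longrightarrow> 0 \<preceq> A + B"
  by (simp add: coeff_le_def lookup_add)

lemma coeff_nonneg_mult: "0 \<preceq> A \<Longrightarrow> 0 \<preceq> B \<Longrightarrow> 0 \<preceq> A * B"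
  by (simp add: coeff_le_def lookup_times_laurent sum_nonneg)

lemma coeff_nonneg_one: "0 \<preceq> 1"
  by (simp add: coeff_le_def lookup_one when_def)

lemma coeff_nonneg_q_plus_q_inv: "0 \<preceq> q + q_inv"
  by (simp add: coeff_le_def q_def q_inv_def lookup_add lookup_single when_def)

lemma coeff_le_mult_right:
  assumes "0 \<preceq> A" "1 \<preceq> B"
  shows "A \<preceq> A * B"
  using coeff_nonneg_mult[of A "B - 1"] assms
  by (simp add: coeff_le_diff right_diff_distrib)

lemma coeff_le_degree:
  assumes "A \<preceq> B" "has_degree A a" "has_degree B b"
  shows "a \<le> b"
proof (rule ccontr)
  assume "\<not> a \<le> b"
  then have "Poly_Mapping.lookup B a = 0" "Poly_Mapping.lookup A a > 0"
    using assms(2,3) by (simp_all add: has_degree_def)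
  moreover have "Poly_Mapping.lookup A a \<le> Poly_Mapping.lookup B a"
    using assms(1) by (simp add: coeff_le_def)
  ultimately show False by simp
qed

lemma one_coeff_le_positive_coeffs:
  assumes "1 \<preceq> A"
  shows "positive_coeffs A"
proof -
  have "1 \<le> Poly_Mapping.lookup A 0"
    using assms by (force simp: coeff_le_def lookup_one dest: spec[of _ 0])
  moreover have "Poly_Mapping.lookup A k \<ge> 0" for k
    using assms coeff_nonneg_one coeff_le_trans by (fastforce simp: coeff_le_def)
  ultimately show ?thesis
    by (force simp: positive_coeffs_def less_le)
qed

text \<open>The difference of the two sides is a sum of products of \<open>q + q\<inverse>\<close>, \<open>B\<close>, \<open>C\<close>, \<open>B - 1\<close>, \<open>C - 1\<close>
  and \<open>B - A\<close>, all of which have nonnegative coefficients.\<close>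

lemma mult_coeff_le_mutated_entry:
  assumes "1 \<preceq> B" "1 \<preceq> C" "A \<preceq> B"
  shows "B * C \<preceq> mutated_entry A B C"
proof -
  have nonneg: "0 \<preceq> B" "0 \<preceq> C"
    using assms coeff_nonneg_one coeff_le_trans by blast+
  have diff: "0 \<preceq> B - 1" "0 \<preceq> C - 1" "0 \<preceq> B - A"
    using assms by (simp_all add: coeff_le_diff)
  have "mutated_entry A B C - B * C
      = (q + q_inv) * (B * (C - 1) + C * (B - 1) + B * C) + (B * C + B * (C - 1) + (B - A))"
    by (simp add: mutated_entry_def algebra_simps)
  also have "0 \<preceq> \<dots>"
    by (intro coeff_nonneg_add coeff_nonneg_mult coeff_nonneg_q_plus_q_inv nonneg diff)
  finally show ?thesis
    by (simp add: coeff_le_diff)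
qed

text \<open>Mutating at an entry below another one makes the new entry the largest, so the property that one
  entry is coefficientwise above the others persists on the way up from the root. It
  is what bounds the subtracted \<open>A\<close> in a mutation.\<close>

definition dominated :: "laurent \<times> laurent \<times> laurent \<Rightarrow> bool" where
  "dominated = (\<lambda>(A, B, C). 1 \<preceq> A \<and> 1 \<preceq> B \<and> 1 \<preceq> C
     \<and> (B \<preceq> A \<and> C \<preceq> A \<or> A \<preceq> B \<and> C \<preceq> B \<or> A \<preceq> C \<and> B \<preceq> C))"

lemma dominated_swap:
  "dominated (A, B, C) \<Longrightarrow> dominated (B, A, C)"
  "dominated (A, B, C) \<Longrightarrow> dominated (A, C, B)"
  by (auto simp: dominated_def)

lemma dominated_mutated_entry:
  assumes one: "1 \<preceq> B" "1 \<preceq> C" and or: "A \<preceq> B \<or> A \<preceq> C"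
  shows "dominated (mutated_entry A B C, B, C)"
proof -
  have BC: "B * C \<preceq> mutated_entry A B C"
    using or
  proof
    assume "A \<preceq> C"
    then have "C * B \<preceq> mutated_entry A C B"
      by (rule mult_coeff_le_mutated_entry[OF one(2,1)])
    then show ?thesis
      by (simp add: mutated_entry_commute mult.commute)
  qed (rule mult_coeff_le_mutated_entry[OF one])
  have nonneg: "0 \<preceq> B" "0 \<preceq> C"
    using one coeff_nonneg_one coeff_le_trans by blast+
  have B: "B \<preceq> mutated_entry A B C"
    using coeff_le_mult_right[OF nonneg(1) one(2)] BC coeff_le_trans by blast
  have C: "C \<preceq> mutated_entry A B C"
    using coeff_le_mult_right[OF nonneg(2) one(1)] BC coeff_le_trans
    by (metis mult.commute)
  show ?thesis
    using one B C coeff_le_trans[OF one(1) B] by (simp add: dominated_def)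
qed

section \<open>Descent to the root\<close>

text \<open>The reduction to sorted degrees: \<open>P\<close> and \<open>Q\<close> are invariant under two transpositions, which
  generate all permutations of the triple.\<close>

lemma sort_triple:
  fixes f :: "'a \<Rightarrow> int"
  assumes "P x y z"
    and P_swap: "\<And>x y z. P x y z \<Longrightarrow> P y x z" "\<And>x y z. P x y z \<Longrightarrow> P x z y"
    and Q_swap: "\<And>x y z. Q x y z \<Longrightarrow> Q y x z" "\<And>x y z. Q x y z \<Longrightarrow> Q x z y"
    and sorted: "\<And>x y z. P x y z \<Longrightarrow> f y \<le> f x \<Longrightarrow> f z \<le> f y \<Longrightarrow> Q x y z"
  shows "Q x y z"
proof -
  have top: "Q x y z" if "P x y z" "f y \<le> f x" "f z \<le> f x" for x y z
    using that sorted[of x y z] sorted[of x z y] P_swap(2) Q_swap(2) by (meson linear)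
  consider "f y \<le> f x" "f z \<le> f x" | "f x \<le> f y" "f z \<le> f y" | "f x \<le> f z" "f y \<le> f z"
    by linarith
  then show ?thesis
    using top[of x y z] top[of y x z] top[of z x y] \<open>P x y z\<close> P_swap Q_swap by cases meson+
qed

text \<open>Induction on the sum of the degrees: mutating at the entry of largest degree lowers it. The
  reversed mutation starts from an entry \<open>A'\<close> of degree \<open>max (b - c - 1) 0\<close>. If \<open>A'\<close> were
  coefficientwise above \<open>B\<close>, this degree would be at least \<open>b\<close>, which only happens for constants,
  that is, at \<open>(1, 1, 1)\<close>, where each entry is above the others. So the reversed mutation always
  goes upwards and keeps the triple dominated.\<close>

lemma positive_leading_solution_descent:
  assumes "positive_leading_solution (A, B, C)"
    and "has_degree A a" "has_degree B b" "has_degree C c"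
  shows "(A, B, C) \<in> tree_vertices \<and> dominated (A, B, C)"
  using assms
proof (induction "nat (a + b + c)" arbitrary: A B C a b c rule: less_induct)
  case less
  \<comment> \<open>Each entry is paired with its degree, so that sorting by degree permutes both together.\<close>
  define P where "P = (\<lambda>n (A, a) (B, b) (C, c). positive_leading_solution (A, B, C)
    \<and> has_degree A a \<and> has_degree B b \<and> has_degree C c \<and> nat (a + b + c) = n)"
  define Q :: "laurent \<times> int \<Rightarrow> laurent \<times> int \<Rightarrow> laurent \<times> int \<Rightarrow> bool" where
    "Q = (\<lambda>(A, a) (B, b) (C, c). (A, B, C) \<in> tree_vertices \<and> dominated (A, B, C))"
  have "Q (A, a) (B, b) (C, c)"
  proof (rule sort_triple[where f = snd and P = "P (nat (a + b + c))"])
    show "P (nat (a + b + c)) (A, a) (B, b) (C, c)"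
      using less.prems by (simp add: P_def)
  next
    fix x y z assume "P (nat (a + b + c)) x y z"
    then show "P (nat (a + b + c)) y x z" "P (nat (a + b + c)) x z y"
      by (auto simp: P_def ac_simps dest: positive_leading_solution_swap split: prod.splits)
  next
    fix x y z assume "Q x y z"
    then show "Q y x z" "Q x z y"
      by (auto simp: Q_def dest: tree_vertices_swap dominated_swap split: prod.splits)
  next
    fix x y z assume xyz: "P (nat (a + b + c)) x y z" "snd y \<le> snd x" "snd z \<le> snd y"
    obtain X d Y e Z g where eq: "x = (X, d)" "y = (Y, e)" "z = (Z, g)"
      by (cases x, cases y, cases z)
    have pls: "positive_leading_solution (X, Y, Z)"
      and deg: "has_degree X d" "has_degree Y e" "has_degree Z g"
      and n: "nat (d + e + g) = nat (a + b + c)" and ord: "e \<le> d" "g \<le> e"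
      using xyz by (auto simp: P_def eq)
    have sol: "is_solution (X, Y, Z)" and sym: "symmetric X" "symmetric Y" "symmetric Z"
      using pls by (auto simp: positive_leading_solution_def simp del: is_solution.simps)
    have g: "g \<ge> 0"
      using symmetric_degree_nonneg sym(3) deg(3) .
    show "Q x y z"
    proof (cases "X = 1 \<and> Y = 1 \<and> Z = 1")
      case True
      then show ?thesis
        by (simp add: Q_def eq tree_vertices_def dominated_def coeff_le_refl)
    next
      case False
      then have d: "d = e + g + 1"
        using solution_degrees[OF sol sym deg ord] by blast
      define X' where "X' = mutated_entry X Y Z"
      have X: "X = mutated_entry X' Y Z"
        by (simp add: X'_def mutated_entry_involution)
      define d' where "d' = max (e - g - 1) 0"
      have "has_degree X' (max (max (e + e) (g + g)) (1 + (e + g)) - d)"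
        unfolding X'_def by (rule has_degree_mutated_entry[OF sol deg])
      also have "max (max (e + e) (g + g)) (1 + (e + g)) - d = d'"
        using d ord g by (simp add: d'_def max_def)
      finally have X'_deg: "has_degree X' d'" .
      have pls': "positive_leading_solution (X', Y, Z)"
        unfolding X'_def by (rule positive_leading_solution_mutated_entry[OF pls])
      have "nat (d' + e + g) < nat (a + b + c)"
        using d ord g by (simp add: d'_def n[symmetric])
      then have IH: "(X', Y, Z) \<in> tree_vertices" "dominated (X', Y, Z)"
        using less.hyps pls' X'_deg deg(2,3) by blast+
      have sol': "is_solution (X', Y, Z)" and sym': "symmetric X'"
        using pls' by (auto simp: positive_leading_solution_def simp del: is_solution.simps)
      have "mutation (X', Y, Z) (X, Y, Z)"
        using mutation.at_fst[OF sol'] X'_deg deg has_degree_nonzero X by simp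
      with IH(1) have tree: "(X, Y, Z) \<in> tree_vertices"
        unfolding tree_vertices_def by (auto intro: rtranclp.rtrancl_into_rtrancl)
      \<comment> \<open>The reversed mutation goes upwards.\<close>
      have "X' \<preceq> Y \<or> X' \<preceq> Z"
      proof (rule ccontr)
        assume no: "\<not> (X' \<preceq> Y \<or> X' \<preceq> Z)"
        then have "Y \<preceq> X'"
          using IH(2) by (auto simp: dominated_def)
        then have "e \<le> d'"
          using coeff_le_degree deg(2) X'_deg by blast
        then have "d' = 0" "e = 0" "g = 0"
          using ord g by (auto simp: d'_def)
        then have "X' = 1 \<and> Y = 1 \<and> Z = 1"
          using solution_degrees[OF sol' sym' sym(2,3) X'_deg deg(2,3)] by simp
        with no show False
          by (simp add: coeff_le_refl)
      qed
      then have "dominated (X, Y, Z)"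
        using IH(2) X dominated_mutated_entry[of Y Z X'] by (simp add: dominated_def)
      with tree show ?thesis
        by (simp add: Q_def eq)
    qed
  qed
  then show ?case
    by (simp add: Q_def)
qed

lemma positive_leading_solution_tree:
  assumes "positive_leading_solution t"
  shows "t \<in> tree_vertices" "dominated t"
proof -
  obtain A B C a b c where "t = (A, B, C)" "has_degree A a" "has_degree B b" "has_degree C c"
    using assms unfolding positive_leading_solution_def by auto
  with assms positive_leading_solution_descent
  show "t \<in> tree_vertices" "dominated t"
    by blast+
qed

theorem proposition2p3:
  shows "{(A, B, C). is_solution (A, B, C)
            \<and> symmetric A \<and> symmetric B \<and> symmetric C
            \<and> positive_coeffs A \<and> positive_coeffs B \<and> positive_coeffs C}
         = tree_vertices"
proof (intro set_eqI iffI)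
  fix t
  assume "t \<in> {(A, B, C). is_solution (A, B, C)
            \<and> symmetric A \<and> symmetric B \<and> symmetric C
            \<and> positive_coeffs A \<and> positive_coeffs B \<and> positive_coeffs C}"
  then obtain A B C where t: "t = (A, B, C)" and "is_solution (A, B, C)"
      "symmetric A" "symmetric B" "symmetric C"
      "positive_coeffs A" "positive_coeffs B" "positive_coeffs C"
    by blast
  then have "positive_leading_solution (A, B, C)"
    by (simp add: positive_leading_solution_def positive_coeffs_has_degree)
  then show "t \<in> tree_vertices"
    using positive_leading_solution_tree t by blast
next
  fix t
  assume t: "t \<in> tree_vertices"
  obtain A B C where eq: "t = (A, B, C)"
    by (cases t)
  have pls: "positive_leading_solution (A, B, C)"
    using tree_vertices_positive_leading_solution t eq by blast
  then have "dominated (A, B, C)"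
    using positive_leading_solution_tree by blast
  then have "positive_coeffs A" "positive_coeffs B" "positive_coeffs C"
    by (auto simp: dominated_def one_coeff_le_positive_coeffs)
  with pls show "t \<in> {(A, B, C). is_solution (A, B, C)
            \<and> symmetric A \<and> symmetric B \<and> symmetric C
            \<and> positive_coeffs A \<and> positive_coeffs B \<and> positive_coeffs C}"
    by (auto simp: eq positive_leading_solution_def simp del: is_solution.simps)
qed

end
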